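(* Let $C_n$ be the cycle graph on $n\ge 3$ vertices and let $L$ be its Laplacian matrix. Then \[ \operatorname{per}(L\circ L)\ \le\ \operatorname{per}(L)^2. \]
   Context: The Laplacian of a simple graph is $L=D-A$ (degree matrix minus adjacency matrix). $\operatorname{per}$ denotes the permanent and $\circ$ the Hadamard (entrywise) product. *)

theory Defs
  imports "Jordan_Normal_Form.Determinant" "Graph_Theory.Pair_Digraph"
begin

text \<open>Simple undirected graphs are the graphs of the locale \<^locale>\<open>pair_graph\<close>: each edge
  \<open>{u, v}\<close> is represented by the two arcs \<open>(u, v)\<close> and \<open>(v, u)\<close>. The degree of a vertex is
  therefore its \<^const>\<open>out_degree\<close>.\<close>

definition degree_matrix :: "nat pair_pre_digraph \<Rightarrow> real mat" where
  "degree_matrix G = mat (card (pverts G)) (card (pverts G))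
     (\<lambda>(i, j). if i = j then real (out_degree (with_proj G) i) else 0)"

definition adjacency_matrix :: "nat pair_pre_digraph \<Rightarrow> real mat" where
  "adjacency_matrix G = mat (card (pverts G)) (card (pverts G))
     (\<lambda>(i, j). if (i, j) \<in> parcs G then 1 else 0)"

text \<open>The rows and columns are indexed by the vertices, so these matrices are meaningful for
  graphs with vertex set \<open>{0..<n}\<close>.\<close>

definition laplacian :: "nat pair_pre_digraph \<Rightarrow> real mat" where
  "laplacian G = degree_matrix G - adjacency_matrix G"

definition cycle_graph :: "nat \<Rightarrow> nat pair_pre_digraph" where
  "cycle_graph n = \<lparr> pverts = {0..<n},
     parcs = {(i, j). i < n \<and> j < n \<and> (j = (i + 1) mod n \<or> i = (j + 1) mod n)} \<rparr>"

text \<open>For \<open>n < 3\<close> the arcs above do not form a cycle (there is a loop for \<open>n = 1\<close>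
  and a single edge for \<open>n = 2\<close>).\<close>

lemma pair_graph_cycle_graph:
  assumes "3 \<le> n"
  shows "pair_graph (cycle_graph n)"
proof
  show "finite (pverts (cycle_graph n))"
    by (simp add: cycle_graph_def)
  have "parcs (cycle_graph n) \<subseteq> {0..<n} \<times> {0..<n}"
    by (auto simp: cycle_graph_def)
  then show "finite (parcs (cycle_graph n))"
    by (rule finite_subset) simp
  show "symmetric (with_proj (cycle_graph n))"
    by (auto simp: cycle_graph_def symmetric_def sym_def)
  fix e assume e: "e \<in> parcs (cycle_graph n)"
  then show "fst e \<in> pverts (cycle_graph n)" "snd e \<in> pverts (cycle_graph n)"
    by (auto simp: cycle_graph_def)
  show "fst e \<noteq> snd e"
    using e assms by (auto simp: cycle_graph_def mod_Suc split: if_splits)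
qed

lemma out_degree_cycle_graph:
  assumes "3 \<le> n" "i < n"
  shows "out_degree (with_proj (cycle_graph n)) i = 2"
proof -
  let ?p = "if i = 0 then n - 1 else i - 1"
  have "out_arcs (with_proj (cycle_graph n)) i = {(i, (i + 1) mod n), (i, ?p)}"
    using assms by (auto simp: out_arcs_def cycle_graph_def mod_Suc split: if_splits)
  moreover have "(i + 1) mod n \<noteq> ?p"
    using assms by (auto simp: mod_Suc split: if_splits)
  ultimately show ?thesis
    by (simp add: out_degree_def)
qed

text \<open>As for \<^const>\<open>det\<close>, the value at a non-square matrix is 0.\<close>

definition permanent :: "'a :: comm_ring_1 mat \<Rightarrow> 'a" where
  "permanent A = (if dim_row A = dim_col A
     then \<Sum>p\<in>{p. p permutes {0..<dim_row A}}. \<Prod>i = 0..<dim_row A. A $$ (i, p i) else 0)"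

definition hadamard_prod :: "'a :: times mat \<Rightarrow> 'a mat \<Rightarrow> 'a mat"  (infixl \<open>\<circ>\<^sub>H\<close> 70) where
  "A \<circ>\<^sub>H B = mat (dim_row A) (dim_col A) (\<lambda>ij. A $$ ij * B $$ ij)"

end

theory Submission
  imports Defs
begin

unbundle no m_inv_syntax

text \<open>Both permanents are sums over the permutations that move every vertex to itself or to a
  neighbour. Let \<open>f p\<close> be the term of \<open>p\<close> in \<open>per(L)\<close>, so \<open>(f p)\<^sup>2\<close> is its term in \<open>per(L \<circ> L)\<close>.
  Such a permutation is either one of the two rotations, with \<open>f p = (-1)^n\<close>, or an
  involution, which has an even number of moved points and hence \<open>f p > 0\<close>. The products of the
  identity term \<open>2^n\<close> with the terms of two transpositions are already large enough to absorb
  the possibly negative products that involve the rotations.\<close>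

section \<open>Sums of squares against squares of sums\<close>

lemma sum_power2_le_power2_sum:
  fixes f :: "'a \<Rightarrow> 'b :: linordered_idom"
  assumes "finite A" "\<And>x. x \<in> A \<Longrightarrow> 0 \<le> f x"
  shows "(\<Sum>x\<in>A. (f x)\<^sup>2) \<le> (\<Sum>x\<in>A. f x)\<^sup>2"
proof -
  have "(\<Sum>x\<in>A. (f x)\<^sup>2) \<le> (\<Sum>x\<in>A. f x * sum f A)"
    unfolding power2_eq_square
    using assms by (intro sum_mono mult_left_mono member_le_sum) auto
  then show ?thesis
    by (simp add: power2_eq_square sum_distrib_right)
qed

text \<open>The two values \<open>e\<close> may be negative. Their cross terms with the rest cost at
  most \<open>4 * (f a + S)\<close>, where \<open>S\<close> is the sum over the elements other than
  \<open>r\<close>, \<open>r'\<close> and \<open>a\<close>; the cross term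
  \<open>2 * (f a * S)\<close> makes up for that.\<close>

lemma sum_power2_le_power2_sum_except_two:
  fixes f :: "'a \<Rightarrow> real"
  assumes fin: "finite A"
    and A: "r \<in> A" "r' \<in> A" "a \<in> A" "b \<in> A" "c \<in> A" "distinct [r, r', a, b, c]"
    and nonneg: "\<And>x. x \<in> A - {r, r'} \<Longrightarrow> 0 \<le> f x"
    and r: "f r = e" "f r' = e" "\<bar>e\<bar> = 1"
    and large: "8 \<le> f a" "2 \<le> f b" "2 \<le> f c"
  shows "(\<Sum>x\<in>A. (f x)\<^sup>2) \<le> (\<Sum>x\<in>A. f x)\<^sup>2"
proof -
  define K where "K = A - {r, r', a}"
  have split: "sum g A = g r + g r' + g a + sum g K" for g :: "'a \<Rightarrow> real"
  proof -
    have "sum g A = sum g (insert r (insert r' (insert a K)))"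
      using A by (intro arg_cong2[where f = sum]) (auto simp: K_def)
    also have "\<dots> = g r + g r' + g a + sum g K"
      using A fin by (simp add: K_def)
    finally show ?thesis .
  qed
  define S where "S = sum f K"
  have "sum f {b, c} \<le> S"
    unfolding S_def using A fin nonneg by (intro sum_mono2) (auto simp: K_def)
  then have S: "4 \<le> S"
    using A large by simp
  have "(\<Sum>x\<in>K. (f x)\<^sup>2) \<le> S\<^sup>2"
    unfolding S_def using fin nonneg by (intro sum_power2_le_power2_sum) (auto simp: K_def)
  moreover have "e\<^sup>2 = 1"
    using r(3) by (simp add: abs_square_eq_1)
  \<comment> \<open>Added up, and with \<open>S\<close> positive, these give
    \<open>4 * (f a + S) \<le> 2 * (f a * S)\<close>.\<close>
  moreover have "f a * 4 \<le> f a * S" "8 * S \<le> f a * S"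
    using S large by (auto intro: mult_left_mono mult_right_mono)
  moreover have "- (f a + S) \<le> e * (f a + S)"
    using mult_right_mono[of "-1" e "f a + S"] r(3) S large by auto
  moreover have "(e + e + f a + S)\<^sup>2 =
      4 * e\<^sup>2 + 4 * (e * (f a + S)) + (f a)\<^sup>2 + 2 * (f a * S) + S\<^sup>2"
    by (simp add: power2_eq_square algebra_simps)
  ultimately have "e\<^sup>2 + e\<^sup>2 + (f a)\<^sup>2 + (\<Sum>x\<in>K. (f x)\<^sup>2) \<le> (e + e + f a + S)\<^sup>2"
    using S by linarith
  then show ?thesis
    unfolding split[of f] split[of "\<lambda>x. (f x)\<^sup>2"] using r by (simp add: S_def)
qed

section \<open>The rotation of the cycle\<close>

definition rot :: "nat \<Rightarrow> nat \<Rightarrow> nat" where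
  "rot n i = (if i < n then (i + 1) mod n else i)"

lemma rot_less: "i < n \<Longrightarrow> rot n i < n"
  by (simp add: rot_def)

lemma rot_permutes: "rot n permutes {0..<n}"
proof -
  have "inj_on (rot n) {0..<n}"
    by (rule inj_onI) (auto simp: rot_def mod_Suc split: if_splits)
  moreover have "rot n ` {0..<n} \<subseteq> {0..<n}"
    by (auto simp: rot_less)
  ultimately have "bij_betw (rot n) {0..<n} {0..<n}"
    by (simp add: bij_betw_def endo_inj_surj)
  then show ?thesis
    by (rule bij_imp_permutes) (simp add: rot_def)
qed

lemma rot_eq_iff: "rot n i = rot n j \<longleftrightarrow> i = j"
  using permutes_inj[OF rot_permutes] by (auto dest: injD)

lemma rot_neq: "3 \<le> n \<Longrightarrow> i < n \<Longrightarrow> rot n i \<noteq> i"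
  by (auto simp: rot_def mod_Suc)

lemma rot_rot_neq: "3 \<le> n \<Longrightarrow> i < n \<Longrightarrow> rot n (rot n i) \<noteq> i"
  by (auto simp: rot_def mod_Suc)

lemma rot_funpow:
  assumes "i < n"
  shows "(rot n ^^ k) i = (i + k) mod n"
  using assms by (induction k) (auto simp: rot_def mod_Suc)

lemma rot_transitive:
  assumes "i < n" "j < n"
  obtains k where "j = (rot n ^^ k) i"
proof
  \<comment> \<open>From \<open>i\<close>, the first \<open>n - i\<close> steps lead round to
    \<open>0\<close> and the next \<open>j\<close> steps to \<open>j\<close>; this covers
    \<open>j < i\<close> as well.\<close>
  show "j = (rot n ^^ (n - i + j)) i"
    using assms by (simp add: rot_funpow)
qed

section \<open>Permutations local to the cycle\<close>

text \<open>For \<open>3 \<le> n\<close>, these are the permutations whose product of Laplacian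
  entries has no zero factor. Writing the backward step as \<open>rot n (p i) = i\<close> avoids
  subtraction modulo \<open>n\<close>.\<close>

definition cycle_local :: "nat \<Rightarrow> (nat \<Rightarrow> nat) \<Rightarrow> bool" where
  "cycle_local n p \<longleftrightarrow> (\<forall>i<n. p i = i \<or> p i = rot n i \<or> rot n (p i) = i)"

text \<open>Inversion exchanges forward and backward steps, so a result about forward steps can be
  applied to \<open>inv p\<close>.\<close>

lemma cycle_local_inv:
  assumes "p permutes {0..<n}" "cycle_local n p"
  shows "cycle_local n (inv p)"
  unfolding cycle_local_def
proof safe
  fix i assume *: "i < n" "inv p i \<noteq> i" "rot n (inv p i) \<noteq> i"
  have "inv p i < n"
    using permutes_in_image[OF permutes_inv[OF assms(1)], of i] * by simp
  then show "inv p i = rot n i"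
    using assms(2) * permutes_inverses(1)[OF assms(1), of i]
    by (auto simp: cycle_local_def)
qed

text \<open>A step forward that is not undone forces the next step to be a forward step that is not
  undone, and so on around the cycle.\<close>

lemma cycle_local_eq_rot:
  assumes n: "3 \<le> n" and p: "p permutes {0..<n}" "cycle_local n p"
    and i: "i < n" "p i = rot n i" "p (rot n i) \<noteq> i"
  shows "p = rot n"
proof -
  have inj: "p x = p y \<longleftrightarrow> x = y" for x y
    using permutes_inj[OF p(1)] by (auto dest: injD)
  have step: "p (rot n j) = rot n (rot n j) \<and> p (rot n (rot n j)) \<noteq> rot n j"
    if j: "j < n" "p j = rot n j" "p (rot n j) \<noteq> j" for j
  proof -
    have "p (rot n j) \<noteq> rot n j"
      using inj[of "rot n j" j] rot_neq[OF n j(1)] j(2) by simp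
    moreover have "rot n (p (rot n j)) \<noteq> rot n j"
      using j(3) by (simp add: rot_eq_iff)
    ultimately have "p (rot n j) = rot n (rot n j)"
      using p(2) rot_less[OF j(1)] by (auto simp: cycle_local_def)
    \<comment> \<open>Otherwise \<open>rot n (rot n j)\<close> and \<open>j\<close> would have the
      same image; they differ because \<open>3 \<le> n\<close>.\<close>
    moreover have "p (rot n (rot n j)) \<noteq> rot n j"
      using inj[of "rot n (rot n j)" j] rot_rot_neq[OF n j(1)] j(2) by simp
    ultimately show ?thesis ..
  qed
  have "(rot n ^^ k) i < n \<and> p ((rot n ^^ k) i) = rot n ((rot n ^^ k) i) \<and>
      p (rot n ((rot n ^^ k) i)) \<noteq> (rot n ^^ k) i" for k
  proof (induction k)
    case (Suc k)
    then show ?case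
      using step[of "(rot n ^^ k) i"] rot_less by simp
  qed (use i in simp)
  then have "p j = rot n j" if "j < n" for j
    using rot_transitive[OF i(1) that] by metis
  moreover have "p j = rot n j" if "\<not> j < n" for j
    using that permutes_not_in[OF p(1), of j] by (simp add: rot_def)
  ultimately show ?thesis
    by blast
qed

text \<open>Apart from the rotations, every forward step is undone by a backward step from the
  vertex it reaches, and conversely. So \<open>rot n\<close> matches the forward movers
  \<open>U\<close> with the backward movers \<open>D\<close>.\<close>

lemma even_card_moved:
  assumes n: "3 \<le> n" and p: "p permutes {0..<n}" "cycle_local n p"
    and not_rot: "p \<noteq> rot n" "p \<noteq> inv (rot n)"
  shows "even (card {i \<in> {0..<n}. p i \<noteq> i})"
proof -
  have backward: "p (rot n i) = i" if "i < n" "p i = rot n i" for i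
    using cycle_local_eq_rot[OF n p that] not_rot by auto
  have forward: "p i = rot n i" if "i < n" "p (rot n i) = i" for i
  proof (rule ccontr)
    assume "p i \<noteq> rot n i"
    \<comment> \<open>Under \<open>inv p\<close> the vertex \<open>i\<close> makes a forward step
      that is not undone, which forces \<open>inv p\<close> to be the rotation.\<close>
    then have "inv p i = rot n i" "inv p (rot n i) \<noteq> i"
      using that(2) permutes_inverses[OF p(1)] by metis+
    then have "inv p = rot n"
      by (intro cycle_local_eq_rot[OF n permutes_inv[OF p(1)] cycle_local_inv[OF p] that(1)])
    then show False
      using not_rot permutes_inv_inv[OF p(1)] by metis
  qed
  define U where "U = {i \<in> {0..<n}. p i = rot n i}"
  define D where "D = {i \<in> {0..<n}. rot n (p i) = i}"
  have "{i \<in> {0..<n}. p i \<noteq> i} = U \<union> D"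
    using p(2) rot_neq[OF n] by (fastforce simp: U_def D_def cycle_local_def)
  \<comment> \<open>The two neighbours of a vertex are distinct since
    \<open>3 \<le> n\<close>.\<close>
  moreover have "U \<inter> D = {}"
    using rot_rot_neq[OF n] by (auto simp: U_def D_def)
  moreover have "D = rot n ` U"
  proof (intro equalityI subsetI)
    fix i assume i: "i \<in> D"
    then have "p i < n"
      using permutes_in_image[OF p(1), of i] by (simp add: D_def)
    moreover have "p (p i) = rot n (p i)"
      using i forward[OF \<open>p i < n\<close>] by (simp add: D_def)
    ultimately show "i \<in> rot n ` U"
      using i by (auto simp: U_def D_def intro!: image_eqI[of _ _ "p i"])
  next
    fix i assume "i \<in> rot n ` U"
    then show "i \<in> D"
      using backward rot_less by (auto simp: U_def D_def)
  qed
  moreover have "finite U" "finite D"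
    by (simp_all add: U_def D_def)
  moreover have "card (rot n ` U) = card U"
    by (intro card_image inj_onI) (simp add: rot_eq_iff)
  ultimately show ?thesis
    by (simp add: card_Un_disjoint)
qed

section \<open>Laplacian entries and the terms of the permanent\<close>

lemma laplacian_cycle_graph_dim [simp]:
  "dim_row (laplacian (cycle_graph n)) = n" "dim_col (laplacian (cycle_graph n)) = n"
  by (simp_all add: laplacian_def degree_matrix_def adjacency_matrix_def cycle_graph_def)

lemma laplacian_cycle_graph_index:
  assumes "3 \<le> n" "i < n" "j < n"
  shows "laplacian (cycle_graph n) $$ (i, j) =
    (if j = i then 2 else if j = rot n i \<or> rot n j = i then - 1 else 0)"
proof -
  have card: "card (pverts (cycle_graph n)) = n"
    by (simp add: cycle_graph_def)
  have "(i, j) \<in> parcs (cycle_graph n) \<longleftrightarrow> j = rot n i \<or> rot n j = i"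
    using assms by (auto simp: cycle_graph_def rot_def)
  then show ?thesis
    using assms rot_neq[of n i]
    by (auto simp: laplacian_def degree_matrix_def adjacency_matrix_def card
        out_degree_cycle_graph)
qed

abbreviation lap_term :: "nat \<Rightarrow> (nat \<Rightarrow> nat) \<Rightarrow> real" where
  "lap_term n p \<equiv> \<Prod>i = 0..<n. laplacian (cycle_graph n) $$ (i, p i)"

lemma lap_term_eq_0:
  assumes "3 \<le> n" "p permutes {0..<n}" "\<not> cycle_local n p"
  shows "lap_term n p = 0"
proof -
  obtain i where i: "i < n" "p i \<noteq> i" "p i \<noteq> rot n i" "rot n (p i) \<noteq> i"
    using assms(3) by (auto simp: cycle_local_def)
  then have "p i < n"
    using permutes_in_image[OF assms(2), of i] by simp
  then have "laplacian (cycle_graph n) $$ (i, p i) = 0"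
    using i assms(1) by (simp add: laplacian_cycle_graph_index)
  then show ?thesis
    using i(1) by (auto simp: prod_zero_iff)
qed

text \<open>A moved point contributes the off-diagonal entry \<open>-1\<close>, a fixed point its
  degree \<open>2\<close>. Hence the sign depends only on the parity of the number of moved
  points.\<close>

lemma lap_term_eq:
  assumes "3 \<le> n" "p permutes {0..<n}" "cycle_local n p"
  shows "lap_term n p = (- 1) ^ card {i \<in> {0..<n}. p i \<noteq> i} * 2 ^ card {i \<in> {0..<n}. p i = i}"
proof -
  have "lap_term n p = (\<Prod>i = 0..<n. if p i \<noteq> i then - 1 else 2)"
  proof (rule prod.cong)
    fix i assume "i \<in> {0..<n}"
    then show "laplacian (cycle_graph n) $$ (i, p i) = (if p i \<noteq> i then - 1 else 2)"
      using assms permutes_in_image[OF assms(2), of i]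
      by (auto simp: laplacian_cycle_graph_index cycle_local_def)
  qed simp
  also have "\<dots> = (- 1) ^ card {i \<in> {0..<n}. p i \<noteq> i} * 2 ^ card {i \<in> {0..<n}. p i = i}"
    by (subst prod.If_cases) (auto simp: Int_def)
  finally show ?thesis .
qed

lemma lap_term_no_fixpoints:
  assumes "3 \<le> n" "p permutes {0..<n}" "cycle_local n p" "\<And>i. i < n \<Longrightarrow> p i \<noteq> i"
  shows "lap_term n p = (- 1) ^ n"
proof -
  have "{i \<in> {0..<n}. p i \<noteq> i} = {0..<n}" "{i \<in> {0..<n}. p i = i} = {}"
    using assms(4) by auto
  then show ?thesis
    by (simp only: lap_term_eq[OF assms(1-3)]) simp
qed

lemma lap_term_id:
  assumes "3 \<le> n"
  shows "lap_term n id = 2 ^ n"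
  using assms by (simp add: laplacian_cycle_graph_index)

lemma lap_term_transpose:
  assumes "3 \<le> n" "Suc i < n"
  shows "lap_term n (transpose i (Suc i)) = 2 ^ (n - 2)"
proof -
  let ?t = "transpose i (Suc i)"
  have "{j \<in> {0..<n}. ?t j \<noteq> j} = {i, Suc i}"
    using assms by (auto simp: transpose_def)
  moreover have "{j \<in> {0..<n}. ?t j = j} = {0..<n} - {i, Suc i}"
    by (auto simp: transpose_def)
  moreover have "card ({0..<n} - {i, Suc i}) = n - 2"
    using assms by (subst card_Diff_subset) auto
  moreover have "?t permutes {0..<n}"
    using assms by (intro permutes_swap_id) auto
  moreover have "cycle_local n ?t"
    using assms by (auto simp: cycle_local_def transpose_def rot_def)
  ultimately show ?thesis
    using assms by (simp add: lap_term_eq)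
qed

section \<open>Permanents of the cycle Laplacian and of its Hadamard square\<close>

theorem theorem5p1:
  fixes n :: nat and L :: "real mat"
  assumes "n \<ge> 3"
  defines "L \<equiv> laplacian (cycle_graph n)"
  shows "permanent (L \<circ>\<^sub>H L) \<le> (permanent L)\<^sup>2"
proof -
  let ?P = "{p. p permutes {0..<n}}"
  let ?t = "\<lambda>i. transpose i (Suc i) :: nat \<Rightarrow> nat"
  note n = assms(1)
  note perm = rot_permutes[of n] permutes_inv[OF rot_permutes[of n]]
  have inv_rot: "inv (rot n) i < n" "rot n (inv (rot n) i) = i" if "i < n" for i
    using permutes_in_image[OF perm(2), of i] permutes_inverses(1)[OF perm(1)] that by auto
  have local_rot: "cycle_local n (rot n)" "cycle_local n (inv (rot n))"
    using inv_rot by (auto simp: cycle_local_def)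
  have inv_rot_neq: "inv (rot n) i \<noteq> i" if "i < n" for i
    using inv_rot(2)[OF that] rot_neq[OF n that] by metis
  have "(\<Sum>p\<in>?P. (lap_term n p)\<^sup>2) \<le> (\<Sum>p\<in>?P. lap_term n p)\<^sup>2"
  proof (rule sum_power2_le_power2_sum_except_two
      [where r = "rot n" and r' = "inv (rot n)" and a = id and b = "?t 0" and c = "?t 1"])
    show "finite ?P"
      by (simp add: finite_permutations)
    show "rot n \<in> ?P" "inv (rot n) \<in> ?P" "id \<in> ?P" "?t 0 \<in> ?P" "?t 1 \<in> ?P"
      using n perm by (auto intro!: permutes_swap_id permutes_id)
    have "rot n \<noteq> inv (rot n)"
      using inv_rot(2)[of 0] rot_rot_neq[OF n, of 0] n by auto
    moreover have "q \<noteq> rot n \<and> q \<noteq> inv (rot n)" if "q \<in> {id, ?t 0, ?t 1}" for q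
    proof -
      \<comment> \<open>A fixed vertex separates \<open>q\<close> from the rotations, which have
        none: \<open>?t 0\<close> fixes \<open>2\<close> and \<open>?t 1\<close> fixes
        \<open>0\<close>.\<close>
      have "q 0 = 0 \<or> q 2 = 2"
        using that by (auto simp: transpose_def)
      then show ?thesis
        using n rot_neq[OF n, of 0] rot_neq[OF n, of 2] inv_rot_neq[of 0] inv_rot_neq[of 2]
        by auto
    qed
    moreover have "?t 0 0 \<noteq> ?t 1 0" "?t 0 0 \<noteq> id 0" "?t 1 1 \<noteq> id 1"
      by (simp_all add: transpose_def)
    then have "?t 0 \<noteq> ?t 1" "?t 0 \<noteq> id" "?t 1 \<noteq> id"
      by metis+
    ultimately show "distinct [rot n, inv (rot n), id, ?t 0, ?t 1]"
      by (auto simp del: One_nat_def)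
    show "0 \<le> lap_term n p" if "p \<in> ?P - {rot n, inv (rot n)}" for p
    proof (cases "cycle_local n p")
      case True
      then show ?thesis
        using that n even_card_moved[of n p] by (simp add: lap_term_eq)
    next
      case False
      then show ?thesis
        using that lap_term_eq_0[OF n, of p] by (metis Diff_iff mem_Collect_eq order_refl)
    qed
    show "lap_term n (rot n) = (- 1) ^ n" "lap_term n (inv (rot n)) = (- 1) ^ n"
      using n perm local_rot rot_neq inv_rot_neq by (auto intro!: lap_term_no_fixpoints)
    show "\<bar>(- 1 :: real) ^ n\<bar> = 1"
      by simp
    show "8 \<le> lap_term n id"
      \<comment> \<open>The threshold 8 is \<open>2 ^ 3\<close>, the value at
        \<open>n = 3\<close>.\<close>
      using power_increasing[OF n, of "2 :: real"] n by (subst lap_term_id) auto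
    have "(2 :: real) \<le> 2 ^ (n - 2)"
      using power_increasing[of 1 "n - 2" "2 :: real"] n by simp
    then show "2 \<le> lap_term n (?t 0)" "2 \<le> lap_term n (?t 1)"
      using n by (simp_all only: lap_term_transpose)
  qed
  moreover have "permanent L = (\<Sum>p\<in>?P. lap_term n p)"
    by (simp add: permanent_def L_def)
  moreover have "permanent (L \<circ>\<^sub>H L) = (\<Sum>p\<in>?P. (lap_term n p)\<^sup>2)"
    by (auto simp: permanent_def L_def hadamard_prod_def power2_eq_square
        permutes_in_image intro!: sum.cong simp flip: prod.distrib)
  ultimately show ?thesis
    by simp
qed

end
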